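(* Let $1\le k\le n$ be integers. The number $R_{n,k}$ of distinct crystallized diagrams consisting of $n$ chords, exactly $k$ of which are short chords, is given by $$R_{n,k}=\sum_{\substack{(p_1,\dots,p_{k(k+1)/2})\\ \sum_i p_i=n-k}}\frac{w_1!\,w_2!\cdots w_{k+1}!}{p_1!\,p_2!\cdots p_{k(k+1)/2}!},$$ where the sum runs over all tuples of non-negative integers $p_1,\dots,p_{k(k+1)/2}$ with sum $n-k$, and $w_i$ is the $i$-th component of the $(k+1)\times 1$ column vector $\mathbf{w}=\mathbf{B}\,\mathbf{p}$, where $\mathbf{B}$ is the $(k+1)\times \frac{k(k+1)}{2}$ (unsigned, $0/1$) vertex-edge incidence matrix of the complete graph on $k+1$ vertices and $\mathbf{p}$ is the column vector formed from the $p_i$.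
   Context: A linear chord diagram with $n$ chords is a perfect matching of the $2n$ vertices $1,2,\dots,2n$ arranged on a line; the matched pairs are called chords. A short chord is a chord joining two adjacent vertices $i,i+1$. A bubble is a non-empty set of consecutive vertices that is bounded on each side either by an end of the diagram or by a short chord, and which contains no vertex of a short chord (equivalently, a maximal run of consecutive vertices none of which belongs to a short chord). A bridge of a bubble is a chord joining a vertex of the bubble to a vertex outside it. A bubble is empty if every vertex of it is attached to a bridge, i.e. no chord has both endpoints in the bubble. A diagram is crystallized if all of its bubbles are empty; equivalently, every chord is either short or joins two different bubbles. *)

theory Defs
  imports Complex_Main "HOL-Library.Disjoint_Sets" "Jordan_Normal_Form.Matrix"
begin

definition linear_chord_diagram :: "nat \<Rightarrow> nat set set \<Rightarrow> bool" where
  "linear_chord_diagram n D \<longleftrightarrow> partition_on {1..2*n} D \<and> (\<forall>c\<in>D. card c = 2)"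

definition short_chords :: "nat set set \<Rightarrow> nat set set" where
  "short_chords D = {c \<in> D. \<exists>i. c = {i, i + 1}}"

definition bubble :: "nat \<Rightarrow> nat set set \<Rightarrow> nat set \<Rightarrow> bool" where
  "bubble n D U \<longleftrightarrow>
     (\<exists>a b. 1 \<le> a \<and> a \<le> b \<and> b \<le> 2*n \<and> U = {a..b} \<and>
        (a = 1 \<or> a - 1 \<in> \<Union> (short_chords D)) \<and>
        (b = 2*n \<or> b + 1 \<in> \<Union> (short_chords D)) \<and>
        U \<inter> \<Union> (short_chords D) = {})"

definition bridges :: "nat set set \<Rightarrow> nat set \<Rightarrow> nat set set" where
  "bridges D U = {c \<in> D. \<exists>x\<in>U. \<exists>y. y \<notin> U \<and> c = {x, y}}"

(* Bubbles are non-empty as sets of vertices; an "empty" bubble has no internal chord. *)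
definition empty_bubble :: "nat set set \<Rightarrow> nat set \<Rightarrow> bool" where
  "empty_bubble D U \<longleftrightarrow> (\<forall>v\<in>U. \<exists>c\<in>bridges D U. v \<in> c)"

definition crystallized :: "nat \<Rightarrow> nat set set \<Rightarrow> bool" where
  "crystallized n D \<longleftrightarrow> (\<forall>U. bubble n D U \<longrightarrow> empty_bubble D U)"

definition crystallized_diagrams :: "nat \<Rightarrow> nat \<Rightarrow> nat set set set" where
  "crystallized_diagrams n k =
     {D. linear_chord_diagram n D \<and> crystallized n D \<and> card (short_chords D) = k}"

definition complete_graph_edges :: "nat \<Rightarrow> nat set set" where
  "complete_graph_edges N = {c. c \<subseteq> {..<N} \<and> card c = 2}"

(* Unsigned vertex-edge incidence matrix of a graph on the vertices 0, ..., N - 1 whose M edges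
   are listed as e 0, ..., e (M - 1). *)
definition incidence_mat :: "nat \<Rightarrow> nat \<Rightarrow> (nat \<Rightarrow> nat set) \<Rightarrow> nat mat" where
  "incidence_mat N M e = mat N M (\<lambda>(i, j). if i \<in> e j then 1 else 0)"

definition weak_compositions :: "nat \<Rightarrow> nat \<Rightarrow> nat vec set" where
  "weak_compositions M s = {p \<in> carrier_vec M. (\<Sum>j<M. p $ j) = s}"

end

theory Submission
  imports Defs
begin

text \<open>Cutting a crystallized diagram at its \<open>k\<close> short chords leaves \<open>k + 1\<close> (possibly empty)
  gaps, and the remaining \<open>n - k\<close> chords join vertices of different gaps. Let \<open>p\<^sub>e\<close> be the
  number of chords joining the two gaps of the pair \<open>e\<close>. The vector \<open>p\<close> fixes the gap sizes
  \<open>w = B p\<close>, and the gap sizes fix the positions of the short chords. It remains to count the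
  matchings of the free vertices with profile \<open>p\<close>. Removing a vertex \<open>v\<close> of gap \<open>i\<close> together
  with its partner, which is one of the \<open>w\<^sub>j\<close> vertices of another gap \<open>j\<close>, lowers
  \<open>p\<close> by one at \<open>{i, j}\<close>; if \<open>R = \<Prod> w\<^sub>i! / \<Prod> p\<^sub>e!\<close>, induction gives
  \<open>w\<^sub>j \<cdot> R p\<^bsub>ij\<^esub> / (w\<^sub>i w\<^sub>j)\<close> matchings for each \<open>j\<close>, and these add up to
  \<open>R\<close> because \<open>\<Sum>\<^sub>j p\<^bsub>ij\<^esub> = w\<^sub>i\<close>.\<close>

section \<open>Matchings joining different colour classes\<close>

definition edges :: "'b set \<Rightarrow> 'b set set" where
  "edges I = {e. e \<subseteq> I \<and> card e = 2}"

text \<open>The colour \<open>g v\<close> will be the gap number of a free vertex \<open>v\<close>.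
  A block whose image has two elements joins different colours, and that image is the pair at which
  \<open>p\<close> counts it.\<close>

definition rainbow_matchings :: "('a \<Rightarrow> 'b) \<Rightarrow> 'b set \<Rightarrow> 'a set \<Rightarrow> ('b set \<Rightarrow> nat) \<Rightarrow> 'a set set set" where
  "rainbow_matchings g I V p = {P. partition_on V P \<and> (\<forall>c\<in>P. card c = 2 \<and> card (g ` c) = 2) \<and>
     (\<forall>e\<in>edges I. card {c\<in>P. g ` c = e} = p e)}"

lemma card_2_obtain:
  assumes "card c = 2" "v \<in> c"
  obtains u where "u \<noteq> v" "c = {v, u}"
proof -
  obtain x y where "c = {x, y}" "x \<noteq> y" using assms(1) by (auto simp: card_2_iff)
  then show thesis using that[of x] that[of y] assms(2) by (auto simp: insert_commute)
qed

lemma finite_edges: "finite I \<Longrightarrow> finite (edges I)"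
  unfolding edges_def by (rule finite_subset[of _ "Pow I"]) auto

lemma finite_rainbow_matchings: "finite V \<Longrightarrow> finite (rainbow_matchings g I V p)"
  by (rule finite_subset[of _ "Pow (Pow V)"]) (auto simp: rainbow_matchings_def partition_on_def)

lemma rainbow_matchings_containing_empty:
  assumes "finite V" "{g v, g u} \<in> edges I" "p {g v, g u} = 0"
  shows "{P \<in> rainbow_matchings g I V p. {v, u} \<in> P} = {}"
proof -
  have False if "P \<in> rainbow_matchings g I V p" "{v, u} \<in> P" for P
  proof -
    have "finite P" using that assms(1) unfolding rainbow_matchings_def
      using finite_elements by blast
    moreover have "card {c\<in>P. g ` c = {g v, g u}} = 0"
      using that assms unfolding rainbow_matchings_def by auto
    ultimately show False using that by auto
  qed
  then show ?thesis by blast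
qed

text \<open>Distinct blocks of a partition are disjoint, so \<open>P\<close> must cover exactly what
  \<open>Q\<close> leaves. This serves to split off one chord in the recursion and all short chords
  of a diagram at once.\<close>

lemma partition_on_Un_iff:
  assumes "partition_on A Q" "A \<subseteq> V" "P \<inter> Q = {}"
  shows "partition_on V (Q \<union> P) \<longleftrightarrow> partition_on (V - A) P"
proof
  assume a: "partition_on V (Q \<union> P)"
  have "c \<inter> d = {}" if "c \<in> Q" "d \<in> P" for c d
    using disjointD[OF partition_onD2[OF a], of c d] that assms(3) by auto
  then show "partition_on (V - A) P"
    using partition_onD1[OF a] partition_onD2[OF a] partition_onD3[OF a] partition_onD1[OF assms(1)]
    by (auto simp: partition_on_def disjoint_def)
next
  assume a: "partition_on (V - A) P"
  have "disjoint (Q \<union> P)"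
    using partition_onD1[OF a] partition_onD1[OF assms(1)]
    by (intro disjoint_union partition_onD2[OF a] partition_onD2[OF assms(1)]) blast
  then show "partition_on V (Q \<union> P)"
    using partition_onD1[OF a] partition_onD3[OF a] assms(2)
      partition_onD1[OF assms(1)] partition_onD3[OF assms(1)]
    by (auto simp: partition_on_def)
qed

lemma partition_on_insert_iff:
  assumes "c \<noteq> {}" "c \<subseteq> V" "c \<notin> P"
  shows "partition_on V (insert c P) \<longleftrightarrow> partition_on (V - c) P"
  using partition_on_Un_iff[OF partition_on_space[OF assms(1)] assms(2), of P] assms(3) by simp

lemma card_Collect_insert:
  assumes "finite P" "c \<notin> P"
  shows "card {x \<in> insert c P. Q x} = card {x \<in> P. Q x} + (if Q c then 1 else 0)"
proof (cases "Q c")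
  case True
  then have "{x \<in> insert c P. Q x} = insert c {x \<in> P. Q x}" by auto
  then show ?thesis using assms True by simp
next
  case False
  then have "{x \<in> insert c P. Q x} = {x \<in> P. Q x}" by auto
  then show ?thesis using False by simp
qed

text \<open>Inserting the chord \<open>{v, u}\<close> is a bijection from the right-hand family to
  the left-hand one, since it raises the count of exactly one colour pair by one.\<close>

lemma card_rainbow_matchings_containing:
  assumes "finite V" "u \<in> V" "v \<in> V" "g u \<noteq> g v" "p {g v, g u} > 0"
  shows "card {P \<in> rainbow_matchings g I V p. {v, u} \<in> P} =
    card (rainbow_matchings g I (V - {v, u}) (p({g v, g u} := p {g v, g u} - 1)))"
    (is "card ?A = card ?B")
proof -
  let ?c = "{v, u}" and ?e = "{g v, g u}"
  have c2: "card ?c = 2" "card (g ` ?c) = 2" using assms(4) by (auto simp: card_insert_if)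
  have key: "insert ?c P \<in> rainbow_matchings g I V p \<longleftrightarrow> P \<in> ?B" if "?c \<notin> P" for P
  proof (cases "partition_on (V - ?c) P")
    case True
    then have "finite P" using assms(1) by (meson finite_Diff finite_elements)
    \<comment> \<open>Positivity of \<open>p\<close> at this pair lets the truncated subtraction be
      undone.\<close>
    then have "card {c \<in> insert ?c P. g ` c = e} = p e \<longleftrightarrow>
      card {c\<in>P. g ` c = e} = (p(?e := p ?e - 1)) e" for e
      using card_Collect_insert[OF _ that, of "\<lambda>c. g ` c = e"] assms(5) by auto
    then show ?thesis
      using partition_on_insert_iff[OF _ _ that, of V] assms c2
      unfolding rainbow_matchings_def by auto
  next
    case False
    then show ?thesis
      using partition_on_insert_iff[OF _ _ that, of V] assms
      unfolding rainbow_matchings_def by auto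
  qed
  have notin: "?c \<notin> P" if "P \<in> ?B" for P
    using that unfolding rainbow_matchings_def partition_on_def by auto
  have "?A = insert ?c ` ?B"
  proof (intro equalityI subsetI)
    fix P assume P: "P \<in> ?A"
    then have ins: "P = insert ?c (P - {?c})" by auto
    then have "P - {?c} \<in> ?B" using key[of "P - {?c}"] P by auto
    then show "P \<in> insert ?c ` ?B" using ins by blast
  next
    fix P assume "P \<in> insert ?c ` ?B"
    then obtain Q where "Q \<in> ?B" "P = insert ?c Q" by blast
    then show "P \<in> ?A" using key[OF notin] by auto
  qed
  moreover have "inj_on (insert ?c) ?B"
    using notin by (intro inj_onI) (metis insert_ident)
  ultimately show ?thesis by (simp add: card_image)
qed

text \<open>Each factor at \<open>x \<in> B\<close> splits as \<open>f x\<close> times the factorial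
  of \<open>f x - 1\<close>. The recursion uses this for \<open>w\<close> at two colours and for
  \<open>p\<close> at a single edge.\<close>

lemma prod_fact_decrement:
  fixes f :: "'a \<Rightarrow> nat"
  assumes "finite A" "B \<subseteq> A" "\<And>x. x \<in> B \<Longrightarrow> f x > 0"
  shows "(\<Prod>x\<in>A. fact (f x)) = (\<Prod>x\<in>B. real (f x)) * (\<Prod>x\<in>A. fact (if x \<in> B then f x - 1 else f x))"
proof -
  have "(\<Prod>x\<in>A. fact (f x)) =
    (\<Prod>x\<in>A. (if x \<in> B then real (f x) else 1) * fact (if x \<in> B then f x - 1 else f x))"
    using assms by (intro prod.cong refl) (auto simp: fact_reduce)
  also have "\<dots> = (\<Prod>x\<in>A. (if x \<in> B then real (f x) else 1)) *
      (\<Prod>x\<in>A. fact (if x \<in> B then f x - 1 else f x))"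
    by (rule prod.distrib)
  also have "(\<Prod>x\<in>A. (if x \<in> B then real (f x) else 1)) = (\<Prod>x\<in>B. real (f x))"
    using assms by (simp add: prod.inter_restrict[symmetric] Int_absorb1)
  finally show ?thesis .
qed

text \<open>The last premise makes the class sizes the degrees of the multigraph with edge
  multiplicities \<open>p\<close>. It is inherited when a chord is removed, which drives the
  induction on the number of vertices.\<close>

lemma card_rainbow_matchings:
  fixes g :: "'a \<Rightarrow> 'b"
  assumes "finite V" "finite I" "g ` V \<subseteq> I"
    and "\<And>i. i \<in> I \<Longrightarrow> card {v\<in>V. g v = i} = (\<Sum>e | e \<in> edges I \<and> i \<in> e. p e)"
  shows "real (card (rainbow_matchings g I V p)) =
    (\<Prod>i\<in>I. fact (card {v\<in>V. g v = i})) / (\<Prod>e\<in>edges I. fact (p e))"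
  using assms
proof (induction "card V" arbitrary: V p rule: less_induct)
  case less
  note finE = finite_edges[OF less.prems(2)]
  show ?case
  proof (cases "V = {}")
    case True
    \<comment> \<open>With no vertices all degrees are 0, so \<open>p\<close> vanishes on every
      edge; the empty matching is the only one and the quotient is 1.\<close>
    have "p e = 0" if e: "e \<in> edges I" for e
    proof -
      obtain i where "i \<in> e" "i \<in> I" using e unfolding edges_def
        by (cases "e = {}") auto
      then show ?thesis using less.prems(4)[of i] e finE True by auto
    qed
    moreover from this have "rainbow_matchings g I V p = {{}}"
      using True by (auto simp: rainbow_matchings_def partition_on_def)
    ultimately show ?thesis using True by simp
  next
    case False
    then obtain v where v: "v \<in> V" by blast
    define w where "w i = card {x\<in>V. g x = i}" for i
    let ?e = "\<lambda>j. {g v, j}"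
    define R where "R = (\<Prod>i\<in>I. fact (w i)) / (\<Prod>e\<in>edges I. fact (p e) :: real)"
    let ?A = "\<lambda>u. {P \<in> rainbow_matchings g I V p. {v, u} \<in> P}"
    let ?U = "{u\<in>V. g u \<noteq> g v}"
    have edge: "?e j \<in> edges I" if "j \<in> I - {g v}" for j
      using that v less.prems(3) by (auto simp: edges_def card_insert_if)
    have wpos: "w (g u) > 0" if "u \<in> V" for u
      using that less.prems(1) unfolding w_def by (auto simp: card_gt_0_iff)
    \<comment> \<open>This is the induction hypothesis for \<open>V - {v, u}\<close> with
      denominators cleared: compared with \<open>R\<close>, the numerator loses
      \<open>w (g v)\<close> and \<open>w (g u)\<close>, the denominator one factor
      \<open>p\<close>. If \<open>p\<close> is 0 there, both sides vanish.\<close>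
    have cA: "real (card (?A u)) * (w (g v) * w (g u)) = R * p (?e (g u))" if u: "u \<in> ?U" for u
    proof (cases "p (?e (g u)) = 0")
      case True
      then have "?A u = {}"
        using rainbow_matchings_containing_empty[OF less.prems(1)] edge u less.prems(3) by blast
      then show ?thesis using True by (simp only: card.empty)
    next
      case pos: False
      let ?V = "V - {v, u}" and ?p = "p(?e (g u) := p (?e (g u)) - 1)"
      let ?ed = "?e (g u)"
      have ed: "?ed \<in> edges I" using edge u less.prems(3) by blast
      \<comment> \<open>As \<open>u\<close> and \<open>v\<close> have different colours, each of the
        two classes loses exactly one vertex.\<close>
      have w': "card {x\<in>?V. g x = i} = (if i \<in> ?ed then w i - 1 else w i)" for i
      proof -
        have "{x\<in>?V. g x = i} = {x\<in>V. g x = i} - (if i = g v then {v} else if i = g u then {u} else {})"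
          using u by auto
        then show ?thesis using u v less.prems(1) unfolding w_def
          by (auto simp: card_Diff_subset)
      qed
      have sum': "card {x\<in>?V. g x = i} = (\<Sum>e | e \<in> edges I \<and> i \<in> e. ?p e)" if i: "i \<in> I" for i
      proof (cases "i \<in> ?ed")
        case True
        have fin: "finite {e. e \<in> edges I \<and> i \<in> e}" using finE by auto
        have mem: "?ed \<in> {e. e \<in> edges I \<and> i \<in> e}" using ed True by auto
        have "w i = p ?ed + (\<Sum>e\<in>{e. e \<in> edges I \<and> i \<in> e} - {?ed}. p e)"
          using less.prems(4)[OF i] sum.remove[OF fin mem, of p] by (simp add: w_def)
        moreover have "(\<Sum>e | e \<in> edges I \<and> i \<in> e. ?p e) =
            (p ?ed - 1) + (\<Sum>e\<in>{e. e \<in> edges I \<and> i \<in> e} - {?ed}. p e)"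
          using sum.remove[OF fin mem, of ?p] by simp
        ultimately show ?thesis using w'[of i] True pos by simp
      next
        case False
        then have "(\<Sum>e | e \<in> edges I \<and> i \<in> e. ?p e) = (\<Sum>e | e \<in> edges I \<and> i \<in> e. p e)"
          by (intro sum.cong) auto
        then show ?thesis using w'[of i] less.prems(4)[OF i] False by (simp add: w_def)
      qed
      have "card ?V < card V"
        using v less.prems(1) by (intro psubset_card_mono) auto
      then have "real (card (rainbow_matchings g I ?V ?p)) =
         (\<Prod>i\<in>I. fact (card {x\<in>?V. g x = i})) / (\<Prod>e\<in>edges I. fact (?p e))"
        using less.prems sum' by (intro less.hyps) auto
      moreover have "card (?A u) = card (rainbow_matchings g I ?V ?p)"
        using card_rainbow_matchings_containing[of V u v g p I] less.prems(1) u v pos by auto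
      moreover have "(\<Prod>i\<in>I. fact (w i)) =
          real (w (g v) * w (g u)) * (\<Prod>i\<in>I. fact (card {x\<in>?V. g x = i}))"
      proof -
        have "(\<Prod>x\<in>?ed. real (w x)) = real (w (g v) * w (g u))" using u by auto
        then show ?thesis
          using prod_fact_decrement[of I ?ed w] less.prems(2,3) u v wpos unfolding w' by auto
      qed
      moreover have "(\<Prod>e\<in>edges I. fact (p e)) = real (p ?ed) * (\<Prod>e\<in>edges I. fact (?p e))"
      proof -
        have "(if e \<in> {?ed} then p e - 1 else p e) = ?p e" for e by auto
        then show ?thesis
          using prod_fact_decrement[of "edges I" "{?ed}" p] finE ed pos by simp
      qed
      moreover have "(\<Prod>e\<in>edges I. fact (?p e) :: real) \<noteq> 0"
        using finE by (simp only: prod_zero_iff) simp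
      ultimately show ?thesis using pos unfolding R_def by (simp add: field_simps)
    qed
    \<comment> \<open>Matchings are classified by the partner \<open>u\<close> of the fixed vertex
      \<open>v\<close>.\<close>
    have "rainbow_matchings g I V p = (\<Union>u\<in>?U. ?A u)"
    proof (intro equalityI subsetI)
      fix P assume P: "P \<in> rainbow_matchings g I V p"
      then have part: "partition_on V P" and c2: "\<And>c. c \<in> P \<Longrightarrow> card c = 2 \<and> card (g ` c) = 2"
        by (auto simp: rainbow_matchings_def)
      obtain c where c: "c \<in> P" "v \<in> c" using v partition_onD1[OF part] by blast
      then obtain u where u: "c = {v, u}" using c2 by (auto elim: card_2_obtain)
      have "g u \<noteq> g v" using c2[OF c(1)] u by auto
      moreover have "u \<in> V" using u c partition_onD1[OF part] by blast
      ultimately show "P \<in> (\<Union>u\<in>?U. ?A u)" using P u c by blast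
    qed auto
    moreover have "card (\<Union>u\<in>?U. ?A u) = (\<Sum>u\<in>?U. card (?A u))"
    proof (intro card_UN_disjoint ballI impI)
      show "finite ?U" using less.prems(1) by auto
      show "finite (?A u)" for u
        by (rule finite_subset[OF _ finite_rainbow_matchings[OF less.prems(1)]]) auto
      fix u u' assume "u \<in> ?U" "u' \<in> ?U" "u \<noteq> u'"
      then have ne: "{v,u} \<noteq> {v,u'}" by (auto simp: doubleton_eq_iff)
      have False if "P \<in> ?A u" "P \<in> ?A u'" for P
      proof -
        have "disjoint P" using that(1) partition_onD2 by (auto simp: rainbow_matchings_def)
        then show False using disjointD[of P "{v,u}" "{v,u'}"] that ne by auto
      qed
      then show "?A u \<inter> ?A u' = {}" by blast
    qed
    \<comment> \<open>The factor \<open>w (g v)\<close> is carried along until the remaining sum of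
      \<open>p\<close> turns out to equal it; it then cancels, being positive because of
      \<open>v\<close>.\<close>
    ultimately have "card (rainbow_matchings g I V p) * real (w (g v)) =
        (\<Sum>u\<in>?U. real (card (?A u)) * real (w (g v)))"
      by (simp add: sum_distrib_right)
    also have "\<dots> = (\<Sum>u\<in>?U. R * p (?e (g u)) / w (g u))"
      using cA wpos by (intro sum.cong refl) (auto simp: field_simps)
    also have "\<dots> = (\<Sum>j\<in>I - {g v}. \<Sum>u | u \<in> ?U \<and> g u = j. R * p (?e (g u)) / w (g u))"
      using less.prems by (intro sum.group[symmetric]) auto
    also have "\<dots> = (\<Sum>j\<in>I - {g v}. R * p (?e j))"
    proof (intro sum.cong refl)
      fix j assume j: "j \<in> I - {g v}"
      have eq: "{u. u \<in> ?U \<and> g u = j} = {x\<in>V. g x = j}" using j by auto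
      have "(\<Sum>u | u \<in> ?U \<and> g u = j. R * p (?e (g u)) / w (g u)) =
        (\<Sum>u | u \<in> ?U \<and> g u = j. R * p (?e j) / w j)"
        by (intro sum.cong) auto
      also have "\<dots> = w j * (R * p (?e j) / w j)" unfolding eq by (simp add: w_def)
      also have "\<dots> = R * p (?e j)"
      \<comment> \<open>For an empty class the division by \<open>w j\<close> gives 0, so
        \<open>p\<close> must be 0 there too; the degree premise provides this.\<close>
      proof (cases "w j = 0")
        case True
        then have "p (?e j) = 0"
          using less.prems(4)[of j] j finE edge[OF j] unfolding w_def by auto
        then show ?thesis by simp
      qed auto
      finally show "(\<Sum>u | u \<in> ?U \<and> g u = j. R * p (?e (g u)) / w (g u)) = R * p (?e j)" .
    qed
    also have "\<dots> = R * real (\<Sum>j\<in>I - {g v}. p (?e j))" by (simp add: sum_distrib_left)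
    also have "(\<Sum>j\<in>I - {g v}. p (?e j)) = w (g v)"
    proof -
      have "w (g v) = (\<Sum>e | e \<in> edges I \<and> g v \<in> e. p e)"
        using less.prems(3,4) v unfolding w_def by blast
      also have "{e. e \<in> edges I \<and> g v \<in> e} = ?e ` (I - {g v})"
      proof (intro equalityI subsetI)
        fix e assume e: "e \<in> {e. e \<in> edges I \<and> g v \<in> e}"
        then obtain j where "e = {g v, j}" unfolding edges_def by (auto elim: card_2_obtain)
        then show "e \<in> ?e ` (I - {g v})" using e unfolding edges_def by (cases "j = g v") auto
      qed (use edge in auto)
      also have "(\<Sum>e\<in>?e ` (I - {g v}). p e) = (\<Sum>j\<in>I - {g v}. p (?e j))"
        by (subst sum.reindex) (auto simp: inj_on_def doubleton_eq_iff)
      finally show ?thesis by simp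
    qed
    finally have "real (card (rainbow_matchings g I V p)) = R" using wpos[OF v] by simp
    then show ?thesis by (simp add: R_def w_def)
  qed
qed

section \<open>Placements of short chords\<close>

definition left_ends :: "nat set set \<Rightarrow> nat set" where
  "left_ends D = {x. {x, Suc x} \<in> D}"

definition adjacent_pairs :: "nat set \<Rightarrow> nat set set" where
  "adjacent_pairs L = (\<lambda>x. {x, Suc x}) ` L"

text \<open>Excluding consecutive left ends makes the chords \<open>{x, Suc x}\<close> pairwise
  disjoint.\<close>

definition placement :: "nat \<Rightarrow> nat set \<Rightarrow> bool" where
  "placement n L \<longleftrightarrow> L \<subseteq> {1..<2 * n} \<and> L \<inter> Suc ` L = {}"

text \<open>The gaps between consecutive short chords are numbered from left to right, starting at 0. A gap
  may be empty, so bubbles are the non-empty gaps. The value \<open>gap L v\<close> is the number of the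
  gap containing \<open>v\<close> only when \<open>v\<close> is a free vertex.\<close>

definition free_vertices :: "nat \<Rightarrow> nat set \<Rightarrow> nat set" where
  "free_vertices n L = {1..2 * n} - (L \<union> Suc ` L)"

definition gap :: "nat set \<Rightarrow> nat \<Rightarrow> nat" where
  "gap L v = card {x \<in> L. x < v}"

lemma short_chords_eq: "short_chords D = adjacent_pairs (left_ends D)"
  unfolding short_chords_def adjacent_pairs_def left_ends_def by auto

lemma Union_adjacent_pairs: "\<Union> (adjacent_pairs L) = L \<union> Suc ` L"
  unfolding adjacent_pairs_def by auto

lemma inj_adjacent_pair: "inj (\<lambda>x::nat. {x, Suc x})"
  by (rule injI) (simp only: doubleton_eq_iff, linarith)

lemma card_adjacent_pairs: "card (adjacent_pairs L) = card L"
  unfolding adjacent_pairs_def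
  by (rule card_image[OF inj_on_subset[OF inj_adjacent_pair]]) simp

lemma left_ends_adjacent_pairs: "left_ends (adjacent_pairs L) = L"
  unfolding left_ends_def adjacent_pairs_def using inj_image_mem_iff[OF inj_adjacent_pair] by simp

lemma finite_placement: "placement n L \<Longrightarrow> finite L"
  unfolding placement_def using finite_subset by blast

lemma partition_on_adjacent_pairs:
  assumes "L \<inter> Suc ` L = {}"
  shows "partition_on (L \<union> Suc ` L) (adjacent_pairs L)"
  using assms by (auto simp: partition_on_def disjoint_def adjacent_pairs_def)

text \<open>Here \<open>P\<close> may still contain adjacent pairs, so \<open>L\<close> need not be
  all of the left ends of the union.\<close>

lemma linear_chord_diagram_Un_iff:
  assumes "placement n L" "P \<inter> adjacent_pairs L = {}"
  shows "linear_chord_diagram n (adjacent_pairs L \<union> P) \<longleftrightarrow>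
    partition_on (free_vertices n L) P \<and> (\<forall>c\<in>P. card c = 2)"
proof -
  have "L \<union> Suc ` L \<subseteq> {1..2 * n}" using assms(1) by (auto simp: placement_def)
  moreover have "card c = 2" if "c \<in> adjacent_pairs L" for c
    using that by (auto simp: adjacent_pairs_def)
  ultimately show ?thesis
    using partition_on_Un_iff[OF partition_on_adjacent_pairs, of L "{1..2 * n}" P] assms
    by (auto simp: linear_chord_diagram_def free_vertices_def placement_def)
qed

lemma placement_left_ends:
  assumes "linear_chord_diagram n D"
  shows "placement n (left_ends D)"
proof -
  have part: "partition_on {1..2*n} D" using assms by (simp add: linear_chord_diagram_def)
  have "x \<in> {1..<2 * n}" if "{x, Suc x} \<in> D" for x
  proof -
    have "{x, Suc x} \<subseteq> {1..2 * n}" using that partition_onD1[OF part] by (metis Union_upper)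
    then show ?thesis by auto
  qed
  moreover have False if "{x, Suc x} \<in> D" "{Suc x, Suc (Suc x)} \<in> D" for x
    using disjointD[OF partition_onD2[OF part] that] injD[OF inj_adjacent_pair, of x "Suc x"] by auto
  ultimately show ?thesis by (auto simp: placement_def left_ends_def)
qed

section \<open>Gap numbers, bubbles and the crystallized condition\<close>

lemma gap_Suc: "finite L \<Longrightarrow> gap L (Suc v) = gap L v + (if v \<in> L then 1 else 0)"
proof -
  assume "finite L"
  moreover have "{x \<in> L. x < Suc v} = (if v \<in> L then insert v {x \<in> L. x < v} else {x \<in> L. x < v})"
    by (auto simp: less_Suc_eq)
  ultimately show ?thesis by (simp add: gap_def)
qed

lemma gap_mono: "finite L \<Longrightarrow> u \<le> v \<Longrightarrow> gap L u \<le> gap L v"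
  unfolding gap_def by (intro card_mono) auto

lemma gap_le_card: "finite L \<Longrightarrow> gap L v \<le> card L"
  unfolding gap_def by (intro card_mono) auto

lemma gap_less: "finite L \<Longrightarrow> x \<in> L \<Longrightarrow> x < v \<Longrightarrow> gap L x < gap L v"
  using gap_Suc[of L x] gap_mono[of L "Suc x" v] by simp

lemma gap_eq_if_free:
  assumes "finite L" "u \<le> v" "\<And>x. x \<in> L \<Longrightarrow> u \<le> x \<Longrightarrow> x < v \<Longrightarrow> False"
  shows "gap L u = gap L v"
proof -
  have "{x \<in> L. x < u} = {x \<in> L. x < v}" using assms(2,3) by (meson not_le order.strict_trans2)
  then show ?thesis by (simp add: gap_def)
qed

text \<open>Gap numbers are monotone and increase just after each left end. Hence a non-empty gap is
  an interval, and a free vertex next to it would have the same gap number, against the choice of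
  its extreme vertices.\<close>

lemma bubble_gap:
  assumes "placement n (left_ends D)" "x \<in> free_vertices n (left_ends D)"
  shows "bubble n D {v \<in> free_vertices n (left_ends D). gap (left_ends D) v = gap (left_ends D) x}"
proof -
  define L where "L = left_ends D"
  define F where "F = free_vertices n L"
  define U where "U = {v \<in> F. gap L v = gap L x}"
  note fin = finite_placement[OF assms(1), folded L_def]
  have F: "v \<in> F \<longleftrightarrow> 1 \<le> v \<and> v \<le> 2 * n \<and> v \<notin> L \<and> v \<notin> Suc ` L" for v
    by (auto simp: F_def free_vertices_def)
  have finU: "finite U" by (auto simp: U_def F_def free_vertices_def)
  have "x \<in> U" using assms(2) by (auto simp: U_def F_def L_def)
  then have "U \<noteq> {}" by blast
  define a b where "a = Min U" and "b = Max U"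
  have a: "a \<in> U" and b: "b \<in> U" using finU \<open>U \<noteq> {}\<close> by (auto simp: a_def b_def)
  have lo: "a \<le> v" and hi: "v \<le> b" if "v \<in> U" for v using that finU by (auto simp: a_def b_def)
  have mem: "v \<in> U" if v: "a \<le> v" "v \<le> b" for v
  proof -
    have g: "gap L v = gap L x"
      using gap_mono[OF fin v(1)] gap_mono[OF fin v(2)] a b by (auto simp: U_def)
    \<comment> \<open>A left end before the free vertex \<open>b\<close> would give \<open>b\<close>
      a larger gap number.\<close>
    have "v \<notin> L"
      using gap_less[OF fin, of v b] v b g F by (cases "v = b") (auto simp: U_def)
    \<comment> \<open>If \<open>v = Suc l\<close> with \<open>l\<close> a left end, then
      \<open>a \<le> l\<close> because \<open>a\<close> is free, and \<open>l\<close> would raise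
      the gap number between \<open>a\<close> and \<open>v\<close>.\<close>
    moreover have "v \<notin> Suc ` L"
    proof
      assume "v \<in> Suc ` L"
      then obtain l where l: "v = Suc l" "l \<in> L" by blast
      then have "a \<le> l" using v(1) a F by (cases "a = v") (auto simp: U_def)
      then show False using gap_less[OF fin l(2), of v] gap_mono[OF fin, of a l] l g a
        by (auto simp: U_def)
    qed
    ultimately show ?thesis using g v a b F by (auto simp: U_def)
  qed
  have U: "U = {a..b}"
  proof (intro equalityI subsetI)
    show "v \<in> {a..b}" if "v \<in> U" for v using lo[OF that] hi[OF that] by simp
    show "v \<in> U" if "v \<in> {a..b}" for v using mem[of v] that by simp
  qed
  have aF: "1 \<le> a" "a \<le> 2 * n" "gap L a = gap L x" and bF: "1 \<le> b" "b \<le> 2 * n" "b \<notin> L" "gap L b = gap L x"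
    using a b F by (auto simp: U_def)
  have "a = 1 \<or> a - 1 \<in> L \<union> Suc ` L"
  proof (rule ccontr)
    assume neg: "\<not> ?thesis"
    obtain a' where a': "a = Suc a'" using aF by (cases a) auto
    have "a' \<in> F" unfolding F using neg a' aF by simp
    moreover have "gap L a' = gap L x" using gap_Suc[OF fin, of a'] neg a' aF by simp
    ultimately show False using lo[of a'] a' by (simp add: U_def)
  qed
  moreover have "b = 2 * n \<or> b + 1 \<in> L \<union> Suc ` L"
  proof (rule ccontr)
    assume neg: "\<not> ?thesis"
    have "Suc b \<in> F" unfolding F using neg bF by simp
    moreover have "gap L (Suc b) = gap L x" using gap_Suc[OF fin, of b] bF by simp
    ultimately show False using hi[of "Suc b"] by (simp add: U_def)
  qed
  moreover have "U \<inter> (L \<union> Suc ` L) = {}" by (auto simp: U_def F)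
  ultimately have "bubble n D U"
    unfolding bubble_def short_chords_eq Union_adjacent_pairs L_def[symmetric]
    using U aF bF lo[OF b] by (intro exI[of _ a] exI[of _ b]) simp
  then show ?thesis by (simp add: U_def F_def L_def)
qed

text \<open>A bubble is an interval without left ends, so the count of earlier left ends is constant
  on it.\<close>

lemma gap_bubble:
  assumes "placement n (left_ends D)" "bubble n D U" "u \<in> U" "v \<in> U"
  shows "gap (left_ends D) u = gap (left_ends D) v"
proof -
  obtain a b where U: "U = {a..b}" "U \<inter> (left_ends D \<union> Suc ` left_ends D) = {}"
    using assms(2) unfolding bubble_def short_chords_eq Union_adjacent_pairs by blast
  have "gap (left_ends D) u = gap (left_ends D) v" if "u \<in> U" "v \<in> U" "u \<le> v" for u v
    by (rule gap_eq_if_free[OF finite_placement[OF assms(1)]]) (use that U in auto)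
  then show ?thesis using assms(3,4) by (metis nat_le_linear)
qed

text \<open>Translates bridges into gap numbers. One direction applies emptiness to the gap of an
  end of the chord, which is a bubble; the other uses that gap numbers are constant on a
  bubble.\<close>

lemma crystallized_iff:
  assumes "linear_chord_diagram n D"
  shows "crystallized n D \<longleftrightarrow> (\<forall>c\<in>D - short_chords D. card (gap (left_ends D) ` c) = 2)"
proof -
  let ?L = "left_ends D"
  let ?g = "gap ?L"
  have part: "partition_on {1..2*n} D" and c2: "\<And>c. c \<in> D \<Longrightarrow> card c = 2"
    using assms by (auto simp: linear_chord_diagram_def)
  note pl = placement_left_ends[OF assms]
  have D: "D = adjacent_pairs ?L \<union> (D - short_chords D)"
    unfolding short_chords_eq by (auto simp: adjacent_pairs_def left_ends_def)
  have "(D - short_chords D) \<inter> adjacent_pairs ?L = {}" unfolding short_chords_eq by blast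
  then have partF: "partition_on (free_vertices n ?L) (D - short_chords D)"
    using linear_chord_diagram_Un_iff[OF pl, of "D - short_chords D"] D assms by simp
  show ?thesis
  proof
    assume cry: "crystallized n D"
    show "\<forall>c\<in>D - short_chords D. card (?g ` c) = 2"
    proof
      fix c assume c: "c \<in> D - short_chords D"
      then obtain x y where xy: "c = {x, y}" "x \<noteq> y" using c2[of c] by (auto simp: card_2_iff)
      let ?U = "{v \<in> free_vertices n ?L. ?g v = ?g x}"
      have free: "x \<in> free_vertices n ?L" "y \<in> free_vertices n ?L"
        using partition_onD1[OF partF] c xy by auto
      then have "empty_bubble D ?U"
        using cry bubble_gap[OF pl] by (auto simp: crystallized_def)
      then obtain d where d: "d \<in> bridges D ?U" "x \<in> d" using free by (auto simp: empty_bubble_def)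
      then have "d = c" using disjointD[OF partition_onD2[OF part], of c d] c xy
        by (auto simp: bridges_def)
      then have "?g y \<noteq> ?g x" using d(1) xy free by (auto simp: bridges_def doubleton_eq_iff)
      then show "card (?g ` c) = 2" using xy by (auto simp: card_insert_if)
    qed
  next
    assume two: "\<forall>c\<in>D - short_chords D. card (?g ` c) = 2"
    show "crystallized n D"
      unfolding crystallized_def empty_bubble_def
    proof (intro allI impI ballI)
      fix U v assume U: "bubble n D U" and v: "v \<in> U"
      then have "v \<in> free_vertices n ?L"
        unfolding bubble_def short_chords_eq Union_adjacent_pairs free_vertices_def by auto
      then obtain c where c: "c \<in> D - short_chords D" "v \<in> c"
        using partition_onD1[OF partF] by auto
      then obtain y where y: "c = {v, y}" using c2[of c] by (auto elim: card_2_obtain)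
      have "card (?g ` {v, y}) = 2" using two c(1) y by blast
      then have "?g v \<noteq> ?g y" by (auto simp: card_insert_if split: if_splits)
      then have "y \<notin> U" using gap_bubble[OF pl U v] by blast
      then show "\<exists>c\<in>bridges D U. v \<in> c" using c y v by (auto simp: bridges_def)
    qed
  qed
qed

text \<open>The vertices before a left end \<open>x\<close> are those of the earlier short chords and those of
  the gaps up to \<open>x\<close>; hence the gap sizes determine the placement of the short chords.\<close>

lemma left_end_eq:
  assumes "placement n L" "x \<in> L"
  shows "x = 1 + 2 * gap L x + (\<Sum>i\<le>gap L x. card {v \<in> free_vertices n L. gap L v = i})"
proof -
  note fin = finite_placement[OF assms(1)]
  define t where "t = gap L x"
  let ?A = "{l \<in> L. l < x}"
  let ?F = "{v \<in> free_vertices n L. gap L v \<le> t}"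
  have x: "1 \<le> x" "x < 2 * n" "x \<notin> Suc ` L" using assms by (auto simp: placement_def)
  have "v < x" if "v \<in> free_vertices n L" "gap L v \<le> t" for v
  proof (rule ccontr)
    assume "\<not> v < x"
    moreover have "v \<noteq> x" using that assms by (auto simp: free_vertices_def)
    ultimately show False using gap_less[OF fin assms(2), of v] that by (simp add: t_def)
  qed
  then have F: "?F = {v \<in> free_vertices n L. v < x}"
    using gap_mono[OF fin, of _ x] by (auto simp: t_def)
  \<comment> \<open>Earlier short chords lie entirely before \<open>x\<close>, since
    \<open>x\<close> is not the right end of one.\<close>
  have "Suc l < x" if "l \<in> ?A" for l using that x by (metis (mono_tags, lifting) Suc_lessI imageI mem_Collect_eq)
  then have un: "{1..<x} = ?F \<union> (?A \<union> Suc ` ?A)"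
    unfolding F using x assms(1) by (auto simp: free_vertices_def placement_def)
  have fins: "finite ?F" "finite ?A" using fin by (auto simp: free_vertices_def)
  have "card (?A \<union> Suc ` ?A) = card ?A + card (Suc ` ?A)"
    using fins assms(1) by (intro card_Un_disjoint) (auto simp: placement_def)
  moreover have "card (Suc ` ?A) = card ?A" by (simp add: card_image)
  moreover have "card (?F \<union> (?A \<union> Suc ` ?A)) = card ?F + card (?A \<union> Suc ` ?A)"
    using fins by (intro card_Un_disjoint) (auto simp: free_vertices_def)
  ultimately have "x - 1 = card ?F + 2 * t"
    using arg_cong[OF un, of card] by (simp add: t_def gap_def)
  moreover have "card ?F = (\<Sum>i\<le>t. card {v \<in> ?F. gap L v = i})"
    using sum.group[of ?F "{..t}" "gap L" "\<lambda>_. 1::nat"] fins by (simp add: image_subset_iff)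
  moreover have "\<dots> = (\<Sum>i\<le>t. card {v \<in> free_vertices n L. gap L v = i})"
    by (intro sum.cong arg_cong[of _ _ card]) auto
  ultimately show ?thesis using x unfolding t_def by linarith
qed

text \<open>The left end of short chord number \<open>t\<close>, counted from 0, if gap
  \<open>i\<close> has size \<open>w i\<close>: before it lie \<open>t\<close> short chords and the
  gaps 0 to \<open>t\<close>, and vertices are numbered from 1.\<close>

definition left_end :: "(nat \<Rightarrow> nat) \<Rightarrow> nat \<Rightarrow> nat" where
  "left_end w t = 1 + 2 * t + (\<Sum>i\<le>t. w i)"

text \<open>The position formula puts \<open>L\<close> inside a set of at most \<open>card L\<close>
  elements, which forces equality.\<close>

lemma placement_unique:
  assumes "placement n L" "\<And>i. i \<le> card L \<Longrightarrow> card {v \<in> free_vertices n L. gap L v = i} = w i"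
  shows "L = left_end w ` {..<card L}"
proof -
  note fin = finite_placement[OF assms(1)]
  have "L \<subseteq> left_end w ` {..<card L}"
  proof
    fix x assume x: "x \<in> L"
    have lt: "gap L x < card L"
      unfolding gap_def by (rule psubset_card_mono[OF fin]) (use x in auto)
    have "x = left_end w (gap L x)"
      using left_end_eq[OF assms(1) x] assms(2) lt by (simp add: left_end_def)
    then show "x \<in> left_end w ` {..<card L}" using lt by blast
  qed
  moreover have "card (left_end w ` {..<card L}) \<le> card L"
    using card_image_le[of "{..<card L}"] by simp
  ultimately show ?thesis by (simp add: card_seteq)
qed

section \<open>Construction of a placement with prescribed gap sizes\<close>

lemma left_end_Suc: "left_end w (Suc t) = left_end w t + 2 + w (Suc t)"
  by (simp add: left_end_def)

lemma left_end_less: "t < t' \<Longrightarrow> left_end w t + 2 \<le> left_end w t'"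
proof (induction t')
  case (Suc t')
  then show ?case by (cases "t = t'") (auto simp: left_end_Suc)
qed simp

lemma left_end_less_iff: "left_end w t < left_end w t' \<longleftrightarrow> t < t'"
  using left_end_less[of t t' w] left_end_less[of t' t w] by (cases t t' rule: linorder_cases) auto

lemma inj_left_end: "inj (left_end w)"
  by (rule injI) (metis left_end_less_iff linorder_neqE_nat less_irrefl)

lemma card_left_ends: "card (left_end w ` {..<k}) = k"
  by (simp add: card_image inj_on_subset[OF inj_left_end])

text \<open>Such a \<open>v\<close> lies after exactly the left ends numbered below
  \<open>i\<close>. Gap 0 has no chord before it, hence the separate case.\<close>

lemma gap_left_end:
  assumes "i \<le> k" "v \<le> left_end w i" "i = 0 \<or> left_end w (i - 1) < v"
  shows "gap (left_end w ` {..<k}) v = i"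
proof -
  have "left_end w t < v \<longleftrightarrow> t < i" for t
    using assms(2,3) left_end_less_iff[of w "i - 1" t] left_end_less_iff[of w t i]
    by (cases "t < i") auto
  then have "{x \<in> left_end w ` {..<k}. x < v} = left_end w ` {..<i}" using assms(1) by auto
  then show ?thesis by (simp add: gap_def card_image inj_on_subset[OF inj_left_end])
qed

context
  fixes n k :: nat and w :: "nat \<Rightarrow> nat"
  assumes total: "2 * k + (\<Sum>i\<le>k. w i) = 2 * n"
begin

text \<open>A fictitious short chord number \<open>k\<close> starts just after the last vertex and
  closes the last gap.\<close>

lemma left_end_k: "left_end w k = Suc (2 * n)"
  using total by (simp add: left_end_def)

lemma placement_left_end: "placement n (left_end w ` {..<k})"
proof -
  have "left_end w t < 2 * n" if "t < k" for t
    using left_end_less[OF that, of w] left_end_k by simp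
  moreover have "left_end w t \<noteq> Suc (left_end w t')" for t t'
    using left_end_less[of t t' w] left_end_less[of t' t w] by (cases t t' rule: linorder_cases) auto
  ultimately show ?thesis by (auto simp: placement_def left_end_def)
qed

lemma card_gap_left_end:
  assumes "i \<le> k"
  shows "card {v \<in> free_vertices n (left_end w ` {..<k}). gap (left_end w ` {..<k}) v = i} = w i"
proof -
  let ?L = "left_end w ` {..<k}"
  note fin = finite_placement[OF placement_left_end]
  \<comment> \<open>The first vertex of gap \<open>i\<close> if that gap is non-empty; in general
    the gap is the half-open interval from \<open>a\<close> to \<open>left_end w i\<close>.\<close>
  define a where "a = left_end w i - w i"
  have a: "a = (if i = 0 then 1 else left_end w (i - 1) + 2)" "a + w i = left_end w i"
    by (cases i; simp add: a_def left_end_def)+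
  have le: "left_end w i \<le> Suc (2 * n)"
    using left_end_less[of i k w] left_end_k assms by (cases "i = k") auto
  have "{v \<in> free_vertices n ?L. gap ?L v = i} = {a..<left_end w i}"
  proof (intro equalityI subsetI)
    fix v assume v: "v \<in> {v \<in> free_vertices n ?L. gap ?L v = i}"
    then have v1: "1 \<le> v" "v \<le> 2 * n" and nL: "v \<notin> ?L" "v \<notin> Suc ` ?L"
      by (auto simp: free_vertices_def)
    have "v < left_end w i"
    proof (cases "i = k")
      case False
      then have m: "left_end w i \<in> ?L" using assms by auto
      have "gap ?L (left_end w i) = i"
        using gap_left_end[OF assms, of "left_end w i" w] left_end_less_iff[of w "i - 1" i] by (cases i) auto
      then show ?thesis using gap_less[OF fin m, of v] v m nL by (cases "v = left_end w i") auto
    qed (use v1 left_end_k in simp)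
    moreover have "a \<le> v"
    proof (cases "i = 0")
      case False
      then have m: "left_end w (i - 1) \<in> ?L" using assms by auto
      have "gap ?L (left_end w (i - 1)) = i - 1"
        using gap_left_end[of "i - 1" k "left_end w (i - 1)" w] assms left_end_less_iff[of w "i - 1 - 1" "i - 1"]
        by (cases "i - 1") auto
      then have "left_end w (i - 1) < v"
        using v False gap_mono[OF fin, of v "left_end w (i - 1)"] by (cases "v \<le> left_end w (i - 1)") auto
      moreover have "v \<noteq> Suc (left_end w (i - 1))" using nL m by blast
      ultimately show ?thesis using a False by simp
    qed (use a v1 in simp)
    ultimately show "v \<in> {a..<left_end w i}" by simp
  next
    fix v assume v: "v \<in> {a..<left_end w i}"
    have "v \<noteq> left_end w t \<and> v \<noteq> Suc (left_end w t)" for t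
    proof (cases "t < i")
      case True
      then show ?thesis using left_end_less_iff[of w "i - 1" t] v a by auto
    next
      case False
      then show ?thesis using left_end_less[of i t w] v by (cases "t = i") auto
    qed
    moreover have "gap ?L v = i" using v a by (intro gap_left_end[OF assms]; cases "i = 0") auto
    ultimately show "v \<in> {v \<in> free_vertices n ?L. gap ?L v = i}"
      using v a le by (auto simp: free_vertices_def split: if_splits)
  qed
  then show ?thesis using a(2) by simp
qed

end

section \<open>Crystallized diagrams with a given profile\<close>

text \<open>Every vertex lies on one chord, and a chord with ends of different colours has one
  vertex of colour \<open>i\<close> or none. Counting by chords therefore expresses class sizes as
  degrees, that is, \<open>w = B p\<close>.\<close>

lemma card_gap_class:
  assumes "partition_on V P" "finite V" "finite I" "g ` V \<subseteq> I"
    and two: "\<And>c. c \<in> P \<Longrightarrow> card c = 2 \<and> card (g ` c) = 2"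
  shows "card {v \<in> V. g v = i} = (\<Sum>e | e \<in> edges I \<and> i \<in> e. card {c \<in> P. g ` c = e})"
proof -
  have finP: "finite P" using assms(1,2) finite_elements by blast
  have sub: "c \<subseteq> V" if "c \<in> P" for c using that partition_onD1[OF assms(1)] by blast
  have one: "card {v \<in> c. g v = i} = (if i \<in> g ` c then 1 else 0)" if c: "c \<in> P" for c
  proof -
    obtain x y where xy: "c = {x, y}" "x \<noteq> y" using two[OF c] by (auto simp: card_2_iff)
    then have "g x \<noteq> g y" using two[OF c] by auto
    then have "{v \<in> c. g v = i} = (if i = g x then {x} else if i = g y then {y} else {})"
      using xy by auto
    then show ?thesis using xy by auto
  qed
  have "{v \<in> V. g v = i} = (\<Union>c\<in>P. {v \<in> c. g v = i})"
    using partition_onD1[OF assms(1)] by auto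
  moreover have "card (\<Union>c\<in>P. {v \<in> c. g v = i}) = (\<Sum>c\<in>P. card {v \<in> c. g v = i})"
  proof (intro card_UN_disjoint ballI impI)
    show "finite {v \<in> c. g v = i}" if "c \<in> P" for c
      using finite_subset[OF sub[OF that] assms(2)] by simp
    show "{v \<in> c. g v = i} \<inter> {v \<in> d. g v = i} = {}" if "c \<in> P" "d \<in> P" "c \<noteq> d" for c d
      using disjointD[OF partition_onD2[OF assms(1)] that] by blast
  qed (rule finP)
  ultimately have "card {v \<in> V. g v = i} = (\<Sum>c\<in>P. if i \<in> g ` c then 1 else 0)"
    using one by simp
  also have "\<dots> = (\<Sum>c | c \<in> P \<and> i \<in> g ` c. 1)" by (simp only: sum.inter_filter[OF finP])
  also have "\<dots> = (\<Sum>e | e \<in> edges I \<and> i \<in> e. \<Sum>c | c \<in> {c \<in> P. i \<in> g ` c} \<and> g ` c = e. 1)"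
  proof (rule sum.group[symmetric])
    show "(`) g ` {c \<in> P. i \<in> g ` c} \<subseteq> {e. e \<in> edges I \<and> i \<in> e}"
      using two sub assms(4) unfolding edges_def by blast
  qed (use finP finite_edges[OF assms(3)] in auto)
  also have "\<dots> = (\<Sum>e | e \<in> edges I \<and> i \<in> e. card {c \<in> P. g ` c = e})"
    by (intro sum.cong refl) (auto intro!: arg_cong[of _ _ card])
  finally show ?thesis .
qed

text \<open>The vector \<open>p\<close> indexed by the edges themselves. Short chords are excluded
  explicitly: \<open>gap\<close> rises by one across each, so they would count as joining
  neighbouring gaps.\<close>

definition profile :: "nat set set \<Rightarrow> nat set \<Rightarrow> nat" where
  "profile D e = card {c \<in> D - short_chords D. gap (left_ends D) ` c = e}"

lemma crystallized_diagramsD: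
  assumes "D \<in> crystallized_diagrams n k"
  defines "L \<equiv> left_ends D"
  shows "placement n L" "card L = k"
    and "partition_on (free_vertices n L) (D - short_chords D)"
    and "\<And>c. c \<in> D - short_chords D \<Longrightarrow> card c = 2 \<and> card (gap L ` c) = 2"
    and "\<And>i. card {v \<in> free_vertices n L. gap L v = i} = (\<Sum>e | e \<in> edges {..k} \<and> i \<in> e. profile D e)"
    and "(\<Sum>e\<in>edges {..k}. profile D e) = n - k"
proof -
  have lcd: "linear_chord_diagram n D" and cry: "crystallized n D" and k: "card (short_chords D) = k"
    using assms(1) by (auto simp: crystallized_diagrams_def)
  let ?P = "D - short_chords D"
  show pl: "placement n L" using placement_left_ends[OF lcd] by (simp add: L_def)
  show cL: "card L = k" using k by (simp add: short_chords_eq card_adjacent_pairs L_def)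
  have D: "D = adjacent_pairs L \<union> ?P"
    unfolding short_chords_eq L_def by (auto simp: adjacent_pairs_def left_ends_def)
  have "?P \<inter> adjacent_pairs L = {}" unfolding short_chords_eq L_def by blast
  then show part: "partition_on (free_vertices n L) ?P"
    using linear_chord_diagram_Un_iff[OF pl, of ?P] D lcd by simp
  show two: "card c = 2 \<and> card (gap L ` c) = 2" if "c \<in> ?P" for c
    using that lcd cry crystallized_iff[OF lcd] by (auto simp: linear_chord_diagram_def L_def)
  have finV: "finite (free_vertices n L)" by (simp add: free_vertices_def)
  have img: "gap L ` free_vertices n L \<subseteq> {..k}"
    using gap_le_card[OF finite_placement[OF pl]] cL by auto
  show "card {v \<in> free_vertices n L. gap L v = i} = (\<Sum>e | e \<in> edges {..k} \<and> i \<in> e. profile D e)" for i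
    using card_gap_class[OF part finV _ img two] by (simp add: profile_def L_def)
  have finP: "finite ?P" using part finV finite_elements by blast
  have "(\<Sum>e\<in>edges {..k}. profile D e) = (\<Sum>e\<in>edges {..k}. \<Sum>c | c \<in> ?P \<and> gap L ` c = e. 1)"
    by (simp add: profile_def L_def)
  also have "\<dots> = (\<Sum>c\<in>?P. 1)"
  proof (rule sum.group[OF finP finite_edges])
    show "(`) (gap L) ` ?P \<subseteq> edges {..k}"
      using two partition_onD1[OF part] img unfolding edges_def by blast
  qed simp
  also have "\<dots> = card D - k"
  proof -
    have sub: "short_chords D \<subseteq> D" by (auto simp: short_chords_def)
    have "finite (short_chords D)"
      unfolding short_chords_eq adjacent_pairs_def
      using finite_placement[OF pl] by (simp add: L_def)
    then show ?thesis using card_Diff_subset[OF _ sub] k by simp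
  qed
  \<comment> \<open>Counting the \<open>2 * n\<close> vertices by chords gives two for each
    chord.\<close>
  also have "card D = n"
  proof -
    have "partition_on {1..2 * n} D" and c2: "\<And>c. c \<in> D \<Longrightarrow> card c = 2"
      using lcd by (auto simp: linear_chord_diagram_def)
    moreover have "finite c" if "c \<in> D" for c using c2[OF that] card_ge_0_finite[of c] by simp
    ultimately have "card {1..2 * n} = (\<Sum>c\<in>D. 2)"
      using product_partition[of "{1..2*n}" D]
      by (simp add: partition_on_def)
    then show ?thesis by simp
  qed
  finally show "(\<Sum>e\<in>edges {..k}. profile D e) = n - k" .
qed

text \<open>The handshake identity: each edge is counted once at each of its two ends.\<close>

lemma sum_edge_degrees:
  assumes "finite I"
  shows "(\<Sum>i\<in>I. \<Sum>e | e \<in> edges I \<and> i \<in> e. p e) = 2 * (\<Sum>e\<in>edges I. p e :: nat)"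
proof -
  have "(\<Sum>i\<in>I. \<Sum>e | e \<in> edges I \<and> i \<in> e. p e) = (\<Sum>e\<in>edges I. \<Sum>i | i \<in> I \<and> i \<in> e. p e)"
    by (rule sum.swap_restrict) (auto simp: assms finite_edges)
  also have "\<dots> = (\<Sum>e\<in>edges I. 2 * p e)"
  proof (rule sum.cong[OF refl])
    fix e assume e: "e \<in> edges I"
    then have "{i. i \<in> I \<and> i \<in> e} = e" by (auto simp: edges_def)
    then show "(\<Sum>i | i \<in> I \<and> i \<in> e. p e) = 2 * p e" using e by (simp add: edges_def)
  qed
  finally show ?thesis by (simp add: sum_distrib_left)
qed

text \<open>The profile fixes the gap sizes and these fix the left ends, so all diagrams counted
  share the same short chords. Removing them is a bijection onto the rainbow matchings of the free
  vertices coloured by gap number.\<close>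

lemma card_crystallized_profile:
  fixes p :: "nat set \<Rightarrow> nat"
  assumes "k \<le> n" and total: "(\<Sum>e\<in>edges {..k}. p e) = n - k"
  defines "w \<equiv> \<lambda>i. \<Sum>e | e \<in> edges {..k} \<and> i \<in> e. p e"
  shows "real (card {D \<in> crystallized_diagrams n k. \<forall>e\<in>edges {..k}. profile D e = p e}) =
    (\<Prod>i\<le>k. fact (w i)) / (\<Prod>e\<in>edges {..k}. fact (p e))"
proof -
  define L where "L = left_end w ` {..<k}"
  let ?A = "adjacent_pairs L" and ?V = "free_vertices n L"
  let ?M = "rainbow_matchings (gap L) {..k} ?V p"
  let ?T = "{D \<in> crystallized_diagrams n k. \<forall>e\<in>edges {..k}. profile D e = p e}"
  have tot: "2 * k + (\<Sum>i\<le>k. w i) = 2 * n"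
    using sum_edge_degrees[of "{..k}" p] total assms(1) by (simp add: w_def)
  have pl: "placement n L" and cL: "card L = k"
    and w: "\<And>i. i \<le> k \<Longrightarrow> card {v \<in> ?V. gap L v = i} = w i"
    using placement_left_end[OF tot] card_left_ends[of w k] card_gap_left_end[OF tot]
    by (auto simp: L_def)
  note finL = finite_placement[OF pl]
  have disj: "P \<inter> ?A = {}" if "P \<in> ?M" for P
  proof -
    have "c \<subseteq> ?V" if "c \<in> P" for c
      using that \<open>P \<in> ?M\<close> unfolding rainbow_matchings_def partition_on_def by blast
    then show ?thesis by (fastforce simp: adjacent_pairs_def free_vertices_def)
  qed
  have "?T = (\<union>) ?A ` ?M"
  proof (intro equalityI subsetI)
    fix D assume D: "D \<in> ?T"
    then have D': "D \<in> crystallized_diagrams n k" and prof: "\<And>e. e \<in> edges {..k} \<Longrightarrow> profile D e = p e"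
      by auto
    note props = crystallized_diagramsD[OF D']
    have "left_ends D = left_end w ` {..<card (left_ends D)}"
    proof (rule placement_unique[OF props(1)])
      show "card {v \<in> free_vertices n (left_ends D). gap (left_ends D) v = i} = w i" for i
        unfolding props(5) w_def using prof by (intro sum.cong) auto
    qed
    then have L: "left_ends D = L" using props(2) by (simp add: L_def)
    have "D - ?A \<in> ?M"
      unfolding rainbow_matchings_def
      using props(3,4) prof by (simp add: profile_def short_chords_eq L)
    moreover have "D = ?A \<union> (D - ?A)" by (auto simp: L[symmetric] adjacent_pairs_def left_ends_def)
    ultimately show "D \<in> (\<union>) ?A ` ?M" by blast
  next
    fix D assume "D \<in> (\<union>) ?A ` ?M"
    then obtain P where P: "P \<in> ?M" and D: "D = ?A \<union> P" by blast
    from P have part: "partition_on ?V P" and two: "\<And>c. c \<in> P \<Longrightarrow> card c = 2 \<and> card (gap L ` c) = 2"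
      and prof: "\<And>e. e \<in> edges {..k} \<Longrightarrow> card {c \<in> P. gap L ` c = e} = p e"
      by (auto simp: rainbow_matchings_def)
    have lcd: "linear_chord_diagram n D"
      using linear_chord_diagram_Un_iff[OF pl disj[OF P]] part two by (auto simp: D)
    \<comment> \<open>Adjacent free vertices lie in the same gap, so a rainbow chord is never short
      and the union has no short chords beyond the intended ones.\<close>
    have "{x, Suc x} \<notin> P" for x
    proof
      assume x: "{x, Suc x} \<in> P"
      then have "x \<notin> L" using partition_onD1[OF part] by (auto simp: free_vertices_def)
      then have "gap L (Suc x) = gap L x" using gap_Suc[OF finL] by simp
      then show False using two[OF x] by simp
    qed
    then have L: "left_ends D = L"
      using left_ends_adjacent_pairs[of L] by (auto simp: D left_ends_def)
    then have short: "short_chords D = ?A" and P': "D - short_chords D = P"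
      using disj[OF P] by (auto simp: short_chords_eq D)
    have "crystallized n D" using crystallized_iff[OF lcd] two by (simp add: P' L)
    moreover have "profile D c = p c" if "c \<in> edges {..k}" for c
      unfolding profile_def P' L by (rule prof[OF that])
    ultimately show "D \<in> ?T"
      using lcd by (simp add: crystallized_diagrams_def short card_adjacent_pairs cL)
  qed
  moreover have "inj_on ((\<union>) ?A) ?M"
    using disj by (intro inj_onI) blast
  ultimately have "card ?T = card ?M" by (simp add: card_image)
  also have "real (card ?M) = (\<Prod>i\<in>{..k}. fact (card {v \<in> ?V. gap L v = i})) / (\<Prod>e\<in>edges {..k}. fact (p e))"
  proof (rule card_rainbow_matchings)
    show "gap L ` ?V \<subseteq> {..k}" using gap_le_card[OF finL] cL by auto
    show "card {v \<in> ?V. gap L v = i} = (\<Sum>e | e \<in> edges {..k} \<and> i \<in> e. p e)" if "i \<in> {..k}" for i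
      using w[of i] that by (simp add: w_def)
  qed (simp_all add: free_vertices_def)
  finally show ?thesis using w by simp
qed

section \<open>Finiteness and summation over all profiles\<close>

lemma finite_weak_compositions: "finite (weak_compositions M s)"
proof (rule finite_subset)
  show "weak_compositions M s \<subseteq> vec M ` (PiE {..<M} (\<lambda>_. {..s}))"
  proof
    fix p assume "p \<in> weak_compositions M s"
    then have p: "dim_vec p = M" "(\<Sum>j<M. p $ j) = s" by (auto simp: weak_compositions_def)
    have "p $ j \<le> s" if "j < M" for j
      using member_le_sum[of j "{..<M}" "($) p"] that p(2) by simp
    moreover have "p = vec M (restrict (($) p) {..<M})" using p(1) by (intro eq_vecI) auto
    ultimately show "p \<in> vec M ` (PiE {..<M} (\<lambda>_. {..s}))" by (intro image_eqI[of _ _ "restrict (($) p) {..<M}"]) (simp_all add: PiE_iff)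
  qed
qed (auto intro: finite_PiE)

lemma finite_crystallized_diagrams: "finite (crystallized_diagrams n k)"
  by (rule finite_subset[of _ "Pow (Pow {1..2 * n})"])
    (auto simp: crystallized_diagrams_def linear_chord_diagram_def partition_on_def)

theorem theorem2:
  fixes n k :: nat and e :: "nat \<Rightarrow> nat set"
  assumes "1 \<le> k" and "k \<le> n"
    and "bij_betw e {..<k * (k + 1) div 2} (complete_graph_edges (k + 1))"
  shows "real (card (crystallized_diagrams n k)) =
    (\<Sum>p \<in> weak_compositions (k * (k + 1) div 2) (n - k).
       let w = incidence_mat (k + 1) (k * (k + 1) div 2) e *\<^sub>v p in
       (\<Prod>i<k + 1. fact (w $ i)) / (\<Prod>j<k * (k + 1) div 2. fact (p $ j)))"
proof -
  define M where "M = k * (k + 1) div 2"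
  let ?T = "crystallized_diagrams n k" and ?W = "weak_compositions M (n - k)"
  have atMost: "{..<k + 1} = {..k}" by auto
  have bij: "bij_betw e {..<M} (edges {..k})"
    using assms(3) by (simp add: M_def complete_graph_edges_def edges_def lessThan_Suc_atMost)
  \<comment> \<open>The profile read as a vector through the numbering \<open>e\<close>; the
    diagrams are then counted fibre by fibre.\<close>
  define \<phi> where "\<phi> D = vec M (\<lambda>j. profile D (e j))" for D
  have "\<phi> ` ?T \<subseteq> ?W"
  proof
    fix q assume "q \<in> \<phi> ` ?T"
    then obtain D where D: "D \<in> ?T" "q = \<phi> D" by blast
    have "(\<Sum>j<M. profile D (e j)) = n - k"
      using sum.reindex_bij_betw[OF bij, of "profile D"] crystallized_diagramsD(6)[OF D(1)] by simp
    then show "q \<in> ?W" by (simp add: D(2) \<phi>_def weak_compositions_def)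
  qed
  then have "card ?T = (\<Sum>p\<in>?W. card {D \<in> ?T. \<phi> D = p})"
    using sum.group[OF finite_crystallized_diagrams finite_weak_compositions, of \<phi> n k M "n - k" "\<lambda>_. 1::nat"]
    by simp
  then have "real (card ?T) = (\<Sum>p\<in>?W. real (card {D \<in> ?T. \<phi> D = p}))" by simp
  also have "\<dots> = (\<Sum>p\<in>?W. let w = incidence_mat (k + 1) M e *\<^sub>v p in
       (\<Prod>i<k + 1. fact (w $ i)) / (\<Prod>j<M. fact (p $ j)))"
  proof (rule sum.cong[OF refl])
    fix p assume "p \<in> ?W"
    then have p: "dim_vec p = M" "(\<Sum>j<M. p $ j) = n - k" by (auto simp: weak_compositions_def)
    \<comment> \<open>Carries \<open>p\<close> back to a function on edges, so that the count for a
      fixed profile applies.\<close>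
    define p' where "p' c = p $ inv_into {..<M} e c" for c
    have p'_e: "p' (e j) = p $ j" if "j < M" for j
      using that bij by (simp add: p'_def bij_betw_def)
    have "\<phi> D = p \<longleftrightarrow> (\<forall>c\<in>edges {..k}. profile D c = p' c)" for D
      using p(1) p'_e unfolding bij_betw_imp_surj_on[OF bij, symmetric]
      by (auto simp: \<phi>_def vec_eq_iff)
    moreover have "(\<Sum>c\<in>edges {..k}. p' c) = n - k"
      using sum.reindex_bij_betw[OF bij, of p'] p'_e p(2) by simp
    ultimately have "real (card {D \<in> ?T. \<phi> D = p}) =
        (\<Prod>i\<le>k. fact (\<Sum>c | c \<in> edges {..k} \<and> i \<in> c. p' c)) / (\<Prod>c\<in>edges {..k}. fact (p' c))"
      using card_crystallized_profile[OF assms(2), of p'] by simp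
    moreover have "(\<Prod>c\<in>edges {..k}. fact (p' c) :: real) = (\<Prod>j<M. fact (p $ j))"
      using prod.reindex_bij_betw[OF bij, of "\<lambda>c. fact (p' c) :: real"] p'_e by simp
    moreover have "(\<Sum>c | c \<in> edges {..k} \<and> i \<in> c. p' c) = (incidence_mat (k + 1) M e *\<^sub>v p) $ i"
      if "i \<le> k" for i
    proof -
      \<comment> \<open>Row \<open>i\<close> of the incidence matrix selects the edges containing
        \<open>i\<close>, so the product with \<open>p\<close> is the degree of gap
        \<open>i\<close>.\<close>
      have "(incidence_mat (k + 1) M e *\<^sub>v p) $ i = (\<Sum>j<M. if i \<in> e j then p' (e j) else 0)"
        using that p(1) p'_e
        by (auto simp: incidence_mat_def scalar_prod_def lessThan_atLeast0 intro!: sum.cong)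
      also have "\<dots> = (\<Sum>c\<in>edges {..k}. if i \<in> c then p' c else 0)"
        by (rule sum.reindex_bij_betw[OF bij])
      also have "\<dots> = (\<Sum>c | c \<in> edges {..k} \<and> i \<in> c. p' c)"
        by (simp add: sum.inter_filter finite_edges)
      finally show ?thesis by simp
    qed
    ultimately show "real (card {D \<in> ?T. \<phi> D = p}) = (let w = incidence_mat (k + 1) M e *\<^sub>v p in
       (\<Prod>i<k + 1. fact (w $ i)) / (\<Prod>j<M. fact (p $ j)))"
      unfolding Let_def atMost by simp
  qed
  finally show ?thesis by (simp only: M_def)
qed

end
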